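(* Let $n$ be a positive integer with $n\ge 10$. Then $r(T_n'',T_n')=r(T_n''',T_n')=r(T_n^3,T_n')=2n-5$.
   Context: All graphs are finite simple graphs. For graphs $G_1,G_2$, the Ramsey number $r(G_1,G_2)$ is the smallest positive integer $N$ such that for every graph $G$ on $N$ vertices, either $G$ contains a (not necessarily induced) subgraph isomorphic to $G_1$, or the complement $\overline{G}$ contains a subgraph isomorphic to $G_2$. $T_n'$ is the unique tree on $n$ vertices with maximum degree $n-2$. On vertex set $\{v_0,\ldots,v_{n-1}\}$: $T_n''$ has edges $v_0v_1,\ldots,v_0v_{n-4},v_1v_{n-3},v_1v_{n-2},v_2v_{n-1}$; $T_n'''$ has edges $v_0v_1,\ldots,v_0v_{n-4},v_1v_{n-3},v_2v_{n-2},v_3v_{n-1}$; $T_n^3$ has edges $v_0v_1,\ldots,v_0v_{n-4},v_{n-4}v_{n-3},v_{n-4}v_{n-2},v_{n-4}v_{n-1}$. *)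

theory Defs
  imports "HOL-Library.Ramsey"
begin

record 'a sgraph =
  verts :: "'a set"
  edges :: "'a set set"

definition simple_graph :: "'a sgraph \<Rightarrow> bool" where
  "simple_graph G \<longleftrightarrow> finite (verts G) \<and> edges G \<subseteq> [verts G]\<^bsup>2\<^esup>"

definition complement :: "'a sgraph \<Rightarrow> 'a sgraph" where
  "complement G = \<lparr>verts = verts G, edges = [verts G]\<^bsup>2\<^esup> - edges G\<rparr>"

definition degree :: "'a sgraph \<Rightarrow> 'a \<Rightarrow> nat" where
  "degree G v = card {e \<in> edges G. v \<in> e}"

definition max_degree :: "'a sgraph \<Rightarrow> nat" where
  "max_degree G = Max (degree G ` verts G)"

definition connected_graph :: "'a sgraph \<Rightarrow> bool" where
  "connected_graph G \<longleftrightarrow> verts G \<noteq> {} \<and>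
     (\<forall>u \<in> verts G. \<forall>v \<in> verts G. (u, v) \<in> {(x, y). {x, y} \<in> edges G}\<^sup>*)"

(* A cycle is the list of its distinct vertices; the index is taken modulo the
   length, so the closing edge from the last vertex back to the first is included. *)
definition is_cycle :: "'a sgraph \<Rightarrow> 'a list \<Rightarrow> bool" where
  "is_cycle G c \<longleftrightarrow> length c \<ge> 3 \<and> distinct c \<and>
     (\<forall>i < length c. {c ! i, c ! (Suc i mod length c)} \<in> edges G)"

definition is_tree :: "'a sgraph \<Rightarrow> bool" where
  "is_tree T \<longleftrightarrow> simple_graph T \<and> connected_graph T \<and> (\<nexists>c. is_cycle T c)"

(* G has a (not necessarily induced) subgraph isomorphic to H. *)
definition contains_copy :: "'a sgraph \<Rightarrow> 'b sgraph \<Rightarrow> bool" where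
  "contains_copy G H \<longleftrightarrow>
     (\<exists>f. inj_on f (verts H) \<and> f ` verts H \<subseteq> verts G \<and> (\<forall>e \<in> edges H. f ` e \<in> edges G))"

(* Host graphs range over graphs whose vertices are natural numbers; every finite
   graph is isomorphic to one of these. *)
definition ramsey_number :: "'a sgraph \<Rightarrow> 'b sgraph \<Rightarrow> nat" where
  "ramsey_number G1 G2 = (LEAST N. N > 0 \<and>
     (\<forall>G :: nat sgraph. simple_graph G \<and> card (verts G) = N \<longrightarrow>
        contains_copy G G1 \<or> contains_copy (complement G) G2))"

(* T_n' is only determined up to isomorphism, so it is a predicate on graphs
   over an arbitrary vertex type. *)
definition is_Tn' :: "nat \<Rightarrow> 'a sgraph \<Rightarrow> bool" where
  "is_Tn' n T \<longleftrightarrow> is_tree T \<and> card (verts T) = n \<and> max_degree T = n - 2"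

(* The vertex v_i is represented by the number i. *)

definition Tn'' :: "nat \<Rightarrow> nat sgraph" where
  "Tn'' n = \<lparr>verts = {0..n - 1},
     edges = {{0, i} | i. 1 \<le> i \<and> i \<le> n - 4} \<union> {{1, n - 3}, {1, n - 2}, {2, n - 1}}\<rparr>"

definition Tn''' :: "nat \<Rightarrow> nat sgraph" where
  "Tn''' n = \<lparr>verts = {0..n - 1},
     edges = {{0, i} | i. 1 \<le> i \<and> i \<le> n - 4} \<union> {{1, n - 3}, {2, n - 2}, {3, n - 1}}\<rparr>"

definition Tn3 :: "nat \<Rightarrow> nat sgraph" where
  "Tn3 n = \<lparr>verts = {0..n - 1},
     edges = {{0, i} | i. 1 \<le> i \<and> i \<le> n - 4}
       \<union> {{n - 4, n - 3}, {n - 4, n - 2}, {n - 4, n - 1}}\<rparr>"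

(* The predicate is_Tn' is inhabited, so statements about all its instances are not vacuous. *)
lemma is_Tn'_exists:
  assumes n: "n \<ge> 4"
  shows "\<exists>T :: nat sgraph. is_Tn' n T"
proof -
  define E :: "nat set set" where
    "E = insert {1, n - 1} ((\<lambda>i. {0, i}) ` {1..n - 2})"
  define T where "T = \<lparr>verts = {0..n - 1}, edges = E\<rparr>"
  have simple: "simple_graph T"
    using n unfolding simple_graph_def T_def E_def nsets_def by (auto simp: card_insert_if)
  let ?R = "{(x, y). {x, y} \<in> E}"
  have symR: "(y, x) \<in> ?R\<^sup>*" if "(x, y) \<in> ?R\<^sup>*" for x y
  proof -
    have "sym ?R" by (auto simp: sym_def insert_commute)
    then have "sym (?R\<^sup>*)" by (rule sym_rtrancl)
    with that show ?thesis by (auto dest: symD)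
  qed
  have from0: "(0, v) \<in> ?R\<^sup>*" if "v \<le> n - 1" for v
  proof -
    consider "v = 0" | "1 \<le> v" "v \<le> n - 2" | "v = n - 1" using \<open>v \<le> n - 1\<close> by linarith
    then show ?thesis
    proof cases
      case 2
      then have "(0, v) \<in> ?R" by (auto simp: E_def)
      then show ?thesis by blast
    next
      case 3
      have "(0, 1) \<in> ?R" "(1, n - 1) \<in> ?R" using n by (auto simp: E_def)
      with 3 show ?thesis by (meson converse_rtrancl_into_rtrancl rtrancl.rtrancl_refl)
    qed simp
  qed
  have conn: "connected_graph T"
    unfolding connected_graph_def
  proof (intro conjI ballI)
    fix u v assume "u \<in> verts T" "v \<in> verts T"
    then have "(u, 0) \<in> ?R\<^sup>*" "(0, v) \<in> ?R\<^sup>*" using from0 symR by (simp_all add: T_def)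
    then show "(u, v) \<in> {(x, y). {x, y} \<in> edges T}\<^sup>*"
      by (simp add: T_def)
  qed (simp add: T_def)
  have leaf: "b = c" if "{a, b} \<in> E" "{a, c} \<in> E" "a \<ge> 2" for a b c
    using that n unfolding E_def by (auto simp: doubleton_eq_iff)
  have acyc: "\<not> is_cycle T c" for c
  proof
    assume cyc: "is_cycle T c"
    let ?m = "length c"
    have m: "?m \<ge> 3" and d: "distinct c"
      and e: "\<And>i. i < ?m \<Longrightarrow> {c ! i, c ! (Suc i mod ?m)} \<in> E"
      using cyc unfolding is_cycle_def T_def by auto
    have small: "c ! (Suc i mod ?m) < 2" if "i < ?m" for i
    proof (rule ccontr)
      assume neg: "\<not> c ! (Suc i mod ?m) < 2"
      let ?j = "Suc i mod ?m"
      have j: "?j < ?m" using m by (intro mod_less_divisor) linarith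
      have "{c ! ?j, c ! i} \<in> E" using e[OF that] by (simp add: insert_commute)
      moreover have "{c ! ?j, c ! (Suc ?j mod ?m)} \<in> E" using e[OF j] .
      ultimately have "c ! i = c ! (Suc ?j mod ?m)" using leaf neg by auto
      moreover have "Suc ?j mod ?m < ?m" using m by (intro mod_less_divisor) linarith
      ultimately have "i = Suc ?j mod ?m" using d that by (simp add: nth_eq_iff_index_eq)
      moreover have "Suc ?j mod ?m \<noteq> i"
        using m that by (cases "Suc i = ?m"; cases "Suc (Suc i) = ?m") auto
      ultimately show False by simp
    qed
    have "Suc (?m - 1) = ?m" using m by linarith
    then have "Suc 0 mod ?m = 1" "Suc 1 mod ?m = 2" "Suc (?m - 1) mod ?m = 0"
      using m by simp_all
    moreover have "0 < ?m" "1 < ?m" "?m - 1 < ?m" using m by linarith+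
    ultimately have "c ! 1 < 2" "c ! 2 < 2" "c ! 0 < 2"
      using small[of 0] small[of 1] small[of "?m - 1"] by metis+
    moreover have "c ! 0 \<noteq> c ! 1" "c ! 0 \<noteq> c ! 2" "c ! 1 \<noteq> c ! 2"
      using nth_eq_iff_index_eq[OF d, of 0 1] nth_eq_iff_index_eq[OF d, of 0 2]
        nth_eq_iff_index_eq[OF d, of 1 2] m by linarith+
    ultimately show False by linarith
  qed
  have deg0: "degree T 0 = n - 2"
  proof -
    have "{e \<in> E. 0 \<in> e} = (\<lambda>i. {0, i}) ` {1..n - 2}" using n by (auto simp: E_def)
    moreover have "inj_on (\<lambda>i. {0, i}) {1..n - 2}"
      by (auto simp: inj_on_def doubleton_eq_iff)
    ultimately show ?thesis by (simp add: degree_def T_def card_image)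
  qed
  have degle: "degree T v \<le> n - 2" if v: "v \<in> verts T" for v
  proof (cases "v = 0")
    case False
    have "{e \<in> E. v \<in> e} \<subseteq> {{0, v}, {1, n - 1}}" using False by (auto simp: E_def)
    then have "card {e \<in> E. v \<in> e} \<le> card {{0, v}, {1, n - 1}}"
      by (intro card_mono) auto
    also have "\<dots> \<le> 2" by (simp add: card_insert_if)
    finally show ?thesis using n by (simp add: degree_def T_def)
  qed (simp add: deg0)
  have "max_degree T = n - 2"
    unfolding max_degree_def
  proof (rule Max_eqI)
    show "finite (degree T ` verts T)" by (simp add: T_def)
    show "y \<le> n - 2" if "y \<in> degree T ` verts T" for y using that degle by auto
    show "n - 2 \<in> degree T ` verts T" using deg0 by (force simp: T_def)
  qed
  moreover have "card (verts T) = n" using n by (simp add: T_def)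
  ultimately show ?thesis
    using simple conn acyc unfolding is_Tn'_def is_tree_def by blast
qed

end

(* Two disjoint cliques of order at most n - 3 give the lower bound: the trees are connected
   of order n, and the complement has maximum degree at most n - 3.

   For the upper bound let G have 2n - 5 vertices, with no T_n' in its complement. If some u has a
   set W of at least n - 2 non-neighbours, then a non-edge of G leaving an (n - 2)-subset of W
   towards a vertex other than u would complete a T_n' in the complement. Hence G contains a
   K_{4,n-4}, which contains all three trees. Otherwise every degree in G is at least n - 3 and
   two non-adjacent vertices always have a common neighbour. If some degree exceeds n - 3, a
   greedy embedding works there. If G is (n - 3)-regular, it suffices to find a vertex v having
   a neighbour with two neighbours at distance two from v (for T_n'' and T_n^3), or two disjoint
   edges from N(v) to the vertices at distance two (for T_n'''); both follow by counting. *)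

theory Submission
  imports Defs
begin

section \<open>Neighbourhoods, degrees and complements\<close>

definition nbrs :: "'a sgraph \<Rightarrow> 'a \<Rightarrow> 'a set" where
  "nbrs G v = {u. {v, u} \<in> edges G}"

lemma nbrs_sym: "u \<in> nbrs G v \<longleftrightarrow> v \<in> nbrs G u"
  by (simp add: nbrs_def insert_commute)

lemma simple_graph_edgeD:
  assumes "simple_graph G" "{u, v} \<in> edges G"
  shows "u \<in> verts G" "v \<in> verts G" "u \<noteq> v"
  using assms by (auto simp: simple_graph_def nsets_def card_insert_if split: if_splits)

lemma nbrs_subset: "simple_graph G \<Longrightarrow> nbrs G v \<subseteq> verts G - {v}"
  by (auto simp: nbrs_def dest: simple_graph_edgeD)

lemma finite_nbrs: "simple_graph G \<Longrightarrow> finite (nbrs G v)"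
  by (meson finite_Diff finite_subset nbrs_subset simple_graph_def)

lemma simple_graph_complement: "simple_graph G \<Longrightarrow> simple_graph (complement G)"
  by (auto simp: simple_graph_def complement_def)

lemma verts_complement [simp]: "verts (complement G) = verts G"
  by (simp add: complement_def)

lemma nbrs_complement:
  assumes "v \<in> verts G"
  shows "nbrs (complement G) v = verts G - {v} - nbrs G v"
  using assms by (auto simp: nbrs_def complement_def nsets_def card_insert_if split: if_splits)

lemma degree_eq_card_nbrs:
  assumes G: "simple_graph G"
  shows "degree G v = card (nbrs G v)"
proof -
  have "{e \<in> edges G. v \<in> e} = (\<lambda>u. {v, u}) ` nbrs G v"
  proof (intro set_eqI iffI)
    fix e assume e: "e \<in> {e \<in> edges G. v \<in> e}"
    then have "card e = 2" using G by (auto simp: simple_graph_def nsets_def)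
    then obtain x y where "e = {x, y}" by (meson card_2_iff)
    then show "e \<in> (\<lambda>u. {v, u}) ` nbrs G v" using e by (auto simp: nbrs_def insert_commute)
  qed (auto simp: nbrs_def)
  moreover have "inj_on (\<lambda>u. {v, u}) (nbrs G v)"
    by (auto simp: inj_on_def doubleton_eq_iff)
  ultimately show ?thesis by (simp add: degree_def card_image)
qed

section \<open>Choosing elements and extending injections by counting\<close>

lemma exists_avoiding:
  assumes "length xs < card A"
  shows "\<exists>x \<in> A. x \<notin> set xs"
proof (rule ccontr)
  assume "\<not> ?thesis"
  then have "card A \<le> card (set xs)" by (intro card_mono) auto
  with assms card_length[of xs] show False by linarith
qed

text \<open>As \<open>h\<close> uses exactly \<open>card J\<close> elements of \<open>L\<close>,
  enough remain for \<open>I - J\<close>. In the embeddings below, \<open>h\<close> fixes the images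
  of the tree vertices that carry further leaves; the other images are arbitrary.\<close>

lemma extend_injection:
  assumes "finite I" "finite L" "J \<subseteq> I" "inj_on h J" "h ` J \<subseteq> L" "card I \<le> card L"
  obtains g where "inj_on g I" "g ` I \<subseteq> L" "\<And>j. j \<in> J \<Longrightarrow> g j = h j"
proof -
  have J: "finite J" using assms finite_subset by blast
  have "card (I - J) \<le> card (L - h ` J)"
    using assms J by (simp add: card_Diff_subset card_image)
  then obtain k where k: "k ` (I - J) \<subseteq> L - h ` J" "inj_on k (I - J)"
    using card_le_inj[of "I - J" "L - h ` J"] assms by blast
  define g where "g = (\<lambda>i. if i \<in> J then h i else k i)"
  have "inj_on g I"
    using k \<open>inj_on h J\<close> by (auto simp: inj_on_def g_def; blast)
  moreover have "g ` I \<subseteq> L" using k assms by (auto simp: g_def)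
  ultimately show thesis using that by (simp add: g_def)
qed

section \<open>The three trees as one family, and how to embed them\<close>

text \<open>The three attachment points may coincide, so that a single embedding argument and a
  single lower bound serve all three trees.\<close>

definition branch_tree :: "nat \<Rightarrow> nat \<Rightarrow> nat \<Rightarrow> nat \<Rightarrow> nat sgraph" where
  "branch_tree n p q r = \<lparr>verts = {0..n - 1},
     edges = {{0, i} | i. 1 \<le> i \<and> i \<le> n - 4} \<union> {{p, n - 3}, {q, n - 2}, {r, n - 1}}\<rparr>"

lemma verts_branch_tree: "verts (branch_tree n p q r) = {0..n - 1}"
  by (simp add: branch_tree_def)

lemma branch_tree_edges:
  shows "i \<in> {1..n - 4} \<Longrightarrow> {0, i} \<in> edges (branch_tree n p q r)"
    and "{p, n - 3} \<in> edges (branch_tree n p q r)" "{q, n - 2} \<in> edges (branch_tree n p q r)"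
    "{r, n - 1} \<in> edges (branch_tree n p q r)"
  by (auto simp: branch_tree_def)

lemma Tn''_eq: "Tn'' n = branch_tree n 1 1 2"
  and Tn'''_eq: "Tn''' n = branch_tree n 1 2 3"
  and Tn3_eq: "Tn3 n = branch_tree n (n - 4) (n - 4) (n - 4)"
  by (simp_all add: Tn''_def Tn'''_def Tn3_def branch_tree_def)

text \<open>The centre goes to \<open>v\<close>, its neighbours into \<open>A\<close>, the outer
  leaves to \<open>x\<close>, \<open>y\<close>, \<open>z\<close>. Injectivity of \<open>h\<close> is
  asked on the set \<open>{p, q, r}\<close> only, since attachment points may coincide.\<close>

lemma contains_branch_tree:
  fixes G :: "'a sgraph"
  assumes G: "simple_graph G" and n: "n \<ge> 5"
    and pqr: "{p, q, r} \<subseteq> {1..n - 4}"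
    and v: "v \<in> verts G" and A: "A \<subseteq> nbrs G v" "card A \<ge> n - 4"
    and x: "distinct [v, x, y, z]" "A \<inter> {x, y, z} = {}"
    and h: "inj_on h {p, q, r}" "h ` {p, q, r} \<subseteq> A"
    and e: "x \<in> nbrs G (h p)" "y \<in> nbrs G (h q)" "z \<in> nbrs G (h r)"
  shows "contains_copy G (branch_tree n p q r)"
proof -
  have fin: "finite A" using A finite_nbrs[OF G] finite_subset by blast
  obtain g where g: "inj_on g {1..n - 4}" "g ` {1..n - 4} \<subseteq> A"
    and gh: "\<And>j. j \<in> {p, q, r} \<Longrightarrow> g j = h j"
    using extend_injection[of "{1..n - 4}" A "{p, q, r}" h] fin pqr h A by auto
  define f where "f = g (0 := v, n - 3 := x, n - 2 := y, n - 1 := z)"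
  have fs: "f 0 = v" "f (n - 3) = x" "f (n - 2) = y" "f (n - 1) = z"
    using n by (auto simp: f_def)
  have fg: "f i = g i" if "i \<in> {1..n - 4}" for i
    using that n by (auto simp: f_def)
  have dom: "{0..n - 1} = {1..n - 4} \<union> {0, n - 3, n - 2, n - 1}" using n by auto
  have Av: "v \<notin> A" "A \<subseteq> verts G" using A nbrs_subset[OF G, of v] by auto
  have xyz: "{x, y, z} \<subseteq> verts G"
    using e nbrs_subset[OF G] by blast
  have "inj_on f {1..n - 4}" using g fg by (simp add: inj_on_def)
  moreover have "inj_on f {0, n - 3, n - 2, n - 1}" using x fs by (auto simp: inj_on_def)
  moreover have im: "f ` {1..n - 4} \<subseteq> A" "f ` {0, n - 3, n - 2, n - 1} = {v, x, y, z}"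
    using g(2) fg fs by auto
  moreover have "A \<inter> {v, x, y, z} = {}" using x Av by blast
  ultimately have "inj_on f {0..n - 1}"
    unfolding dom inj_on_Un by blast
  moreover have "f ` {0..n - 1} \<subseteq> verts G"
    unfolding dom image_Un im(2) using im(1) Av xyz v by blast
  moreover have "f ` e \<in> edges G" if "e \<in> edges (branch_tree n p q r)" for e
  proof -
    from that consider i where "e = {0, i}" "i \<in> {1..n - 4}"
      | "e = {p, n - 3}" | "e = {q, n - 2}" | "e = {r, n - 1}"
      by (auto simp: branch_tree_def)
    then show ?thesis
    proof cases
      case 1
      then have "f i \<in> nbrs G v" using im(1) A by blast
      then show ?thesis using 1 fs by (simp add: nbrs_def)
    qed (use e gh pqr fg fs in \<open>auto simp: nbrs_def\<close>)
  qed
  ultimately show ?thesis unfolding contains_copy_def verts_branch_tree by blast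
qed

text \<open>The tree is bipartite: the centre and the three outer leaves form a class of size 4,
  hosted by \<open>Q\<close>, and the \<open>n - 4\<close> neighbours of the centre form the other,
  hosted by \<open>A\<close>.\<close>

lemma branch_tree_of_complete_bipartite:
  assumes G: "simple_graph G" and n: "n \<ge> 7"
    and pqr: "{p, q, r} \<subseteq> {1..n - 4}"
    and Q: "Q \<subseteq> verts G" "card Q = 4" and A: "A \<inter> Q = {}" "card A \<ge> n - 4"
    and adj: "\<And>a w. a \<in> A \<Longrightarrow> w \<in> Q \<Longrightarrow> a \<in> nbrs G w"
  shows "contains_copy G (branch_tree n p q r)"
proof -
  obtain v x y z where Qe: "Q = {v, x, y, z}" "distinct [v, x, y, z]"
    using Q(2) by (auto simp: numeral_eq_Suc card_Suc_eq)
  have "A \<subseteq> nbrs G v" using adj Qe by auto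
  then have fin: "finite A" using finite_nbrs[OF G] finite_subset by blast
  have "card {p, q, r} \<le> card A"
    using A n card_length[of "[p, q, r]"] by simp
  then obtain h where "h ` {p, q, r} \<subseteq> A" "inj_on h {p, q, r}"
    using card_le_inj[of "{p, q, r}" A] fin by blast
  then show ?thesis
    using contains_branch_tree[OF G _ pqr, of v A x y z h] Qe A n adj Q nbrs_sym[of _ G]
      \<open>A \<subseteq> nbrs G v\<close> by auto
qed

section \<open>The structure of T_n' and its embedding\<close>

lemma is_cycle_triangle:
  assumes "distinct [a, b, c]" "{a, b} \<in> edges G" "{b, c} \<in> edges G" "{c, a} \<in> edges G"
  shows "is_cycle G [a, b, c]"
proof -
  have "i = 0 \<or> i = 1 \<or> i = 2" if "i < length [a, b, c]" for i
    using that by auto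
  then show ?thesis unfolding is_cycle_def using assms by fastforce
qed

lemma is_cycle_square:
  assumes "distinct [a, b, c, d]" "{a, b} \<in> edges G" "{b, c} \<in> edges G" "{c, d} \<in> edges G"
    "{d, a} \<in> edges G"
  shows "is_cycle G [a, b, c, d]"
proof -
  have "i = 0 \<or> i = 1 \<or> i = 2 \<or> i = 3" if "i < length [a, b, c, d]" for i
    using that by auto
  then show ?thesis unfolding is_cycle_def using assms by fastforce
qed

text \<open>A vertex \<open>c\<close> of degree \<open>n - 2\<close> misses a single vertex
  \<open>y\<close>. An edge between neighbours of \<open>c\<close> would close a triangle, and two
  common neighbours of \<open>c\<close> and \<open>y\<close> a square. So T_n' is a star with one
  edge subdivided.\<close>

lemma is_Tn'_structure:
  assumes T: "is_Tn' n T" and n: "n \<ge> 4"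
  obtains c y s where "c \<in> verts T" "card (nbrs T c) = n - 2" "s \<in> nbrs T c"
    "y \<notin> nbrs T c" "y \<noteq> c" "verts T = insert c (insert y (nbrs T c))"
    "edges T = insert {s, y} ((\<lambda>u. {c, u}) ` nbrs T c)"
proof -
  have G: "simple_graph T" and con: "connected_graph T" and acyc: "\<And>c. \<not> is_cycle T c"
    and cV: "card (verts T) = n" and md: "max_degree T = n - 2"
    using T by (auto simp: is_Tn'_def is_tree_def)
  have fin: "finite (verts T)" "verts T \<noteq> {}" using G cV n by (auto simp: simple_graph_def)
  have "max_degree T \<in> degree T ` verts T"
    unfolding max_degree_def using fin by (intro Max_in) auto
  then obtain c where c: "c \<in> verts T" "card (nbrs T c) = n - 2"
    using md degree_eq_card_nbrs[OF G] by auto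
  let ?S = "nbrs T c"
  have S: "?S \<subseteq> verts T - {c}" "finite ?S" using nbrs_subset[OF G] finite_nbrs[OF G] by auto
  have "card (verts T - {c} - ?S) = 1"
    using S c n cV fin by (simp add: card_Diff_subset)
  then obtain y where y: "verts T - {c} - ?S = {y}" by (meson card_1_singletonE)
  have noedge: "{a, b} \<notin> edges T" if "a \<in> ?S" "b \<in> ?S" for a b
  proof
    assume ab: "{a, b} \<in> edges T"
    then have "is_cycle T [c, a, b]"
      using that S simple_graph_edgeD[OF G ab]
      by (intro is_cycle_triangle) (auto simp: nbrs_def insert_commute)
    with acyc show False by blast
  qed
  have uniq: "a = b" if "a \<in> ?S" "b \<in> ?S" "{a, y} \<in> edges T" "{b, y} \<in> edges T" for a b
  proof (rule ccontr)
    assume "a \<noteq> b"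
    moreover have "y \<noteq> c" "y \<notin> ?S" using y by auto
    ultimately have "is_cycle T [c, a, y, b]"
      using that S
      by (intro is_cycle_square) (auto simp: nbrs_def insert_commute)
    with acyc show False by blast
  qed
  have split: "v = c \<or> v = y \<or> v \<in> ?S" if "v \<in> verts T" for v using y that by blast
  have yc: "{c, y} \<notin> edges T" "y \<noteq> c" using y by (auto simp: nbrs_def)
  \<comment> \<open>The first edge of a walk from \<open>y\<close> to \<open>c\<close> supplies
    \<open>s\<close>; it differs from \<open>c\<close> because \<open>y\<close> is not adjacent to
    \<open>c\<close>.\<close>
  have "(y, c) \<in> {(x, y). {x, y} \<in> edges T}\<^sup>*"
    using con c y unfolding connected_graph_def by blast
  then obtain s where s: "{y, s} \<in> edges T"
    using yc by (cases rule: converse_rtranclE) auto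
  have "s \<in> verts T" "s \<noteq> y" "s \<noteq> c"
    using simple_graph_edgeD[OF G s] s yc by (auto simp: insert_commute)
  then have sS: "s \<in> ?S" using split by blast
  have "edges T = insert {s, y} ((\<lambda>u. {c, u}) ` ?S)"
  proof (intro set_eqI iffI)
    fix e assume e: "e \<in> edges T"
    then have "card e = 2" using G by (auto simp: simple_graph_def nsets_def)
    then obtain a b where ab: "e = {a, b}" by (meson card_2_iff)
    have abE: "{a, b} \<in> edges T" "{b, a} \<in> edges T" using e ab by (auto simp: insert_commute)
    have "a \<in> verts T" "b \<in> verts T" "a \<noteq> b" using simple_graph_edgeD[OF G abE(1)] by auto
    then consider "a = c" | "b = c" | "a \<in> ?S" "b \<in> ?S" | "a \<in> ?S" "b = y" | "b \<in> ?S" "a = y"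
      using split[of a] split[of b] by blast
    then show "e \<in> insert {s, y} ((\<lambda>u. {c, u}) ` ?S)"
    proof cases
      case 1 then show ?thesis using abE ab by (auto simp: nbrs_def)
    next
      case 2 then show ?thesis using abE ab by (auto simp: nbrs_def insert_commute)
    next
      case 3 then show ?thesis using abE noedge by auto
    next
      case 4 then show ?thesis using uniq[of a s] sS s ab abE by (simp add: insert_commute)
    next
      case 5 then show ?thesis using uniq[of b s] sS s ab abE by (simp add: insert_commute)
    qed
  next
    fix e assume "e \<in> insert {s, y} ((\<lambda>u. {c, u}) ` ?S)"
    then show "e \<in> edges T" using s by (auto simp: nbrs_def insert_commute)
  qed
  moreover have "verts T = insert c (insert y ?S)" using split y c S by blast
  ultimately show thesis using that[OF c sS] y by blast
qed

text \<open>\<open>u\<close> hosts the centre, \<open>w\<close> the subdividing vertex and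
  \<open>x\<close> the leaf behind it. As \<open>x\<close> may itself be adjacent to
  \<open>u\<close>, the neighbours of \<open>u\<close> are counted without it.\<close>

lemma contains_Tn':
  assumes T: "is_Tn' n T" and n: "n \<ge> 4" and H: "simple_graph H"
    and u: "u \<in> verts H" and w: "w \<in> nbrs H u" and x: "x \<in> nbrs H w" "x \<noteq> u"
    and card: "card (nbrs H u - {x}) \<ge> n - 2"
  shows "contains_copy H T"
proof -
  obtain c y s where c: "c \<in> verts T" "card (nbrs T c) = n - 2" and s: "s \<in> nbrs T c"
    and y: "y \<notin> nbrs T c" "y \<noteq> c" and V: "verts T = insert c (insert y (nbrs T c))"
    and E: "edges T = insert {s, y} ((\<lambda>u. {c, u}) ` nbrs T c)"
    by (rule is_Tn'_structure[OF T n])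
  have G: "simple_graph T" using T by (auto simp: is_Tn'_def is_tree_def)
  have "c \<notin> nbrs T c" using nbrs_subset[OF G] by blast
  have xw: "x \<noteq> w" "x \<in> verts H" using x nbrs_subset[OF H] by blast+
  obtain g where g: "inj_on g (nbrs T c)" "g ` nbrs T c \<subseteq> nbrs H u - {x}" and gs: "g s = w"
    using extend_injection[of "nbrs T c" "nbrs H u - {x}" "{s}" "\<lambda>_. w"]
      finite_nbrs[OF G] finite_nbrs[OF H] s w xw c card by auto
  define f where "f = g (c := u, y := x)"
  have f: "f c = u" "f y = x" "\<And>i. i \<in> nbrs T c \<Longrightarrow> f i = g i"
    using y \<open>c \<notin> nbrs T c\<close> by (auto simp: f_def)
  have im: "f ` nbrs T c \<subseteq> nbrs H u - {x}" using f g by auto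
  have un: "u \<notin> nbrs H u" "nbrs H u \<subseteq> verts H" using nbrs_subset[OF H] by blast+
  have "inj_on f (nbrs T c)" using f g by (simp add: inj_on_def)
  then have "inj_on f (verts T)"
    unfolding V using im un f x(2) y by (auto simp: inj_on_insert)
  moreover have "f ` verts T \<subseteq> verts H" unfolding V using im un f u xw by auto
  moreover have "f ` e \<in> edges H" if "e \<in> edges T" for e
  proof -
    from that consider "e = {s, y}" | i where "e = {c, i}" "i \<in> nbrs T c" by (auto simp: E)
    then show ?thesis
    proof cases
      case 1 then show ?thesis using f s gs x by (simp add: nbrs_def)
    next
      case 2
      then have "f i \<in> nbrs H u" using im by blast
      then show ?thesis using 2 f by (simp add: nbrs_def)
    qed
  qed
  ultimately show ?thesis unfolding contains_copy_def by blast
qed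

section \<open>A vertex with many non-neighbours\<close>

lemma large_codegree_contains_branch_tree:
  assumes G: "simple_graph G" and V: "card (verts G) = 2 * n - 5" and n: "n \<ge> 7"
    and pqr: "{p, q, r} \<subseteq> {1..n - 4}"
    and T: "is_Tn' n T" and no: "\<not> contains_copy (complement G) T"
    and u: "u \<in> verts G" and deg: "card (nbrs (complement G) u) \<ge> n - 2"
  shows "contains_copy G (branch_tree n p q r)"
proof -
  let ?W = "nbrs (complement G) u"
  have H: "simple_graph (complement G)" using G by (rule simple_graph_complement)
  have fV: "finite (verts G)" using G by (simp add: simple_graph_def)
  have W: "?W \<subseteq> verts G - {u}" "finite ?W" using nbrs_subset[OF H] finite_nbrs[OF H] by auto
  \<comment> \<open>Otherwise the complement has T_n' with centre \<open>u\<close> and outer path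
    from \<open>w\<close> to \<open>x\<close>. The last condition matters only for \<open>x\<close>
    inside \<open>?W\<close>.\<close>
  have adj: "x \<in> nbrs G w"
    if "w \<in> ?W" "x \<in> verts G" "x \<noteq> u" "x \<noteq> w" "card (?W - {x}) \<ge> n - 2" for w x
  proof (rule ccontr)
    assume "x \<notin> nbrs G w"
    then have "x \<in> nbrs (complement G) w"
      using that W by (auto simp: nbrs_complement)
    with that have "contains_copy (complement G) T"
      using contains_Tn'[OF T _ H, of u w x] u n by simp
    with no show False by simp
  qed
  obtain Q where Q: "Q \<subseteq> ?W" "card Q = 4" "finite Q"
    by (rule obtain_subset_with_card_n[of 4 ?W]) (use deg n in auto)
  \<comment> \<open>If \<open>?W\<close> has exactly \<open>n - 2\<close> elements, none can be
    spared, and the vertices outside it number \<open>2n - 6 - (n - 2) = n - 4\<close>. If it is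
    larger, one element can be spared, and everything except \<open>u\<close> and \<open>Q\<close>
    qualifies, which is \<open>2n - 10\<close> vertices.\<close>
  define A where "A = (if card ?W = n - 2 then verts G - {u} - ?W else verts G - {u} - Q)"
  have Qs: "Q \<subseteq> verts G - {u}" using Q W by blast
  have "card (verts G - {u}) = 2 * n - 6" using u fV V by simp
  then have "card A \<ge> n - 4"
    using n W Q Qs by (auto simp: A_def card_Diff_subset)
  moreover have "A \<inter> Q = {}" using Q by (auto simp: A_def)
  moreover have "a \<in> nbrs G w" if a: "a \<in> A" and w: "w \<in> Q" for a w
  proof (rule adj)
    show "card (?W - {a}) \<ge> n - 2"
      using a deg W by (cases "a \<in> ?W") (auto simp: A_def split: if_splits)
  qed (use a w Q in \<open>auto simp: A_def split: if_splits\<close>)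
  ultimately show ?thesis
    using branch_tree_of_complete_bipartite[OF G n pqr, of Q A] Q Qs by blast
qed

section \<open>Graphs of minimum degree at least n - 3\<close>

locale dense_graph =
  fixes G :: "'a sgraph" and n :: nat
  assumes simple: "simple_graph G" and n: "n \<ge> 9"
    and card_verts: "card (verts G) = 2 * n - 5"
    and min_degree: "\<And>v. v \<in> verts G \<Longrightarrow> card (nbrs G v) \<ge> n - 3"
begin

abbreviation N :: "'a \<Rightarrow> 'a set" where "N \<equiv> nbrs G"

text \<open>By \<open>far_common_nbr\<close>, these are precisely the vertices at distance two from
  \<open>v\<close>, when \<open>v\<close> is a vertex of \<open>G\<close>.\<close>

definition far :: "'a \<Rightarrow> 'a set" where "far v = verts G - {v} - N v"

lemma N_verts: "a \<in> N v \<Longrightarrow> a \<in> verts G"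
  using nbrs_subset[OF simple] by blast

lemma N_neq: "a \<in> N v \<Longrightarrow> a \<noteq> v"
  using nbrs_subset[OF simple] by blast

lemma fin: "finite (verts G)" "finite (N v)"
  using simple finite_nbrs[OF simple] by (auto simp: simple_graph_def)

lemma card_far: "v \<in> verts G \<Longrightarrow> card (far v) = 2 * n - 6 - card (N v)"
  unfolding far_def using nbrs_subset[OF simple, of v] fin card_verts
  by (simp add: card_Diff_subset)

lemma pick_nbr:
  assumes "a \<in> N v" "length xs < n - 3"
  obtains x where "x \<in> N a" "x \<notin> set xs"
  using exists_avoiding[of xs "N a"] min_degree[OF N_verts[OF assms(1)]] assms(2) by fastforce

text \<open>Without a common neighbour, all of \<open>N b\<close> would lie in
  \<open>far v - {b}\<close>, which has at most \<open>n - 4\<close> elements.\<close>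

lemma far_common_nbr:
  assumes "v \<in> verts G" "b \<in> far v"
  obtains a where "a \<in> N v" "b \<in> N a"
proof -
  have "\<not> N b \<subseteq> far v - {b}"
  proof
    assume "N b \<subseteq> far v - {b}"
    then have "card (N b) \<le> card (far v) - 1"
      using assms fin card_mono[of "far v - {b}" "N b"] by (simp add: far_def)
    moreover have "card (N b) \<ge> n - 3" "card (N v) \<ge> n - 3"
      using assms min_degree by (auto simp: far_def)
    ultimately show False using card_far[OF assms(1)] n by linarith
  qed
  then obtain a where a: "a \<in> N b" "a \<notin> far v" using N_neq by blast
  moreover have "a \<noteq> v" using a(1) assms(2) nbrs_sym[of a G b] by (auto simp: far_def)
  ultimately have "a \<in> N v" using N_verts by (auto simp: far_def)
  then show thesis using that a nbrs_sym by metis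
qed

text \<open>With the centre placed at \<open>v\<close>, there must remain \<open>n - 4\<close> neighbours of \<open>v\<close> after the three
  vertices at distance two from the centre have been removed. Once two of these are removed at
  the cost of at most \<open>card (N v) - (n - 3)\<close> neighbours, the third can be chosen freely.\<close>

lemma large_degree_edge:
  assumes "v \<in> verts G" "card (N v) \<ge> n - 2"
  obtains a b where "a \<in> N v" "b \<in> N a" "b \<noteq> v" "card (N v - {b}) \<ge> n - 2"
proof (cases "card (N v) = n - 2")
  case True
  \<comment> \<open>With degree exactly \<open>n - 2\<close> no neighbour may be lost, so
    \<open>b\<close> is taken among the \<open>n - 4\<close> vertices outside
    \<open>N v\<close>.\<close>
  then have "far v \<noteq> {}" using card_far[OF assms(1)] n by fastforce
  then obtain b where b: "b \<in> far v" by blast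
  then obtain a where a: "a \<in> N v" "b \<in> N a" using far_common_nbr assms by blast
  then show ?thesis using that[of a b] b True by (auto simp: far_def)
next
  case False
  then have big: "card (N v) \<ge> n - 1" using assms by simp
  then obtain a where a: "a \<in> N v" using n by fastforce
  obtain b where "b \<in> N a" "b \<notin> set [v]" by (rule pick_nbr[OF a, of "[v]"]) (use n in auto)
  moreover have "card (N v - {b}) \<ge> card (N v) - 1"
    by (simp add: card_Diff_singleton_if)
  ultimately show ?thesis using that[of a b] a big by auto
qed

text \<open>Serves T_n'' and T_n^3, where some neighbour of the centre carries at least two leaves.
  A degree above \<open>n - 3\<close> leaves room to lose one neighbour; in the regular case
  \<open>x\<close> and \<open>y\<close> are found in \<open>far v\<close>, since otherwise some
  \<open>N v\<close> would be too large.\<close>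

lemma fork:
  obtains v a x y where "v \<in> verts G" "a \<in> N v" "x \<in> N a" "y \<in> N a" "distinct [v, x, y]"
    "card (N v - {x, y}) \<ge> n - 3"
proof (cases "\<exists>v \<in> verts G. card (N v) \<ge> n - 2")
  case True
  then obtain v a b where v: "v \<in> verts G" "a \<in> N v" "b \<in> N a" "b \<noteq> v"
    and c: "card (N v - {b}) \<ge> n - 2" using large_degree_edge by blast
  obtain y where y: "y \<in> N a" "y \<notin> set [v, b]"
    by (rule pick_nbr[of a v "[v, b]"]) (use v n in auto)
  have "card (N v - {b} - {y}) \<ge> card (N v - {b}) - 1"
    by (simp add: card_Diff_singleton_if)
  moreover have "N v - {b} - {y} = N v - {b, y}" by blast
  ultimately have "card (N v - {b, y}) \<ge> n - 3" using c by simp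
  then show ?thesis using that[of v a b y] v y by auto
next
  case False
  then have reg: "card (N v) = n - 3" if "v \<in> verts G" for v
    using min_degree that by fastforce
  have cfar: "card (far v) = n - 3" if "v \<in> verts G" for v
    using card_far reg that n by simp
  have "\<exists>v \<in> verts G. \<exists>a \<in> N v. \<exists>x \<in> N a. \<exists>y \<in> N a. x \<noteq> y \<and> x \<in> far v \<and> y \<in> far v"
  proof (rule ccontr)
    assume "\<not> ?thesis"
    then have uniq: "x = y"
      if "v \<in> verts G" "a \<in> N v" "x \<in> N a" "y \<in> N a" "x \<in> far v" "y \<in> far v" for v a x y
      using that by blast
    have "verts G \<noteq> {}" using card_verts n by auto
    then obtain v where v: "v \<in> verts G" by blast
    \<comment> \<open>Three far vertices are taken because the two connectors besides
      \<open>a\<close> are what overfills \<open>N v\<close> in the end.\<close>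
    obtain b where b: "b \<in> far v"
      by (rule bexE[OF exists_avoiding[of "[]" "far v"]]) (use cfar[OF v] n in auto)
    obtain b' where b': "b' \<in> far v" "b' \<noteq> b"
      by (rule bexE[OF exists_avoiding[of "[b]" "far v"]]) (use cfar[OF v] n in auto)
    obtain b'' where b'': "b'' \<in> far v" "b'' \<noteq> b" "b'' \<noteq> b'"
      by (rule bexE[OF exists_avoiding[of "[b, b']" "far v"]]) (use cfar[OF v] n in auto)
    obtain a where a: "a \<in> N v" "b \<in> N a" using far_common_nbr v b by blast
    obtain a' where a': "a' \<in> N v" "b' \<in> N a'" using far_common_nbr v b' by blast
    obtain a'' where a'': "a'' \<in> N v" "b'' \<in> N a''" using far_common_nbr v b'' by blast
    have bV: "b \<in> verts G" "v \<in> far b" "v \<in> N a"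
      using v b a nbrs_sym[of v G b] nbrs_sym[of v G a] by (auto simp: far_def)
    \<comment> \<open>These \<open>n - 4\<close> vertices turn out to be common neighbours of
      \<open>v\<close> and \<open>b\<close>. Together with \<open>a'\<close> and \<open>a''\<close>
      they give \<open>n - 2\<close> elements of \<open>N v\<close>, one more than regularity
      allows.\<close>
    let ?C = "insert a (N a - {v, b})"
    have sub: "?C \<subseteq> N v \<inter> N b"
    proof
      fix c assume c: "c \<in> ?C"
      have "c \<in> N v \<and> c \<in> N b" if "c \<noteq> a"
      proof -
        have ca: "c \<in> N a" "c \<noteq> v" "c \<noteq> b" using c that by auto
        \<comment> \<open>\<open>a\<close> already has \<open>b\<close> as its one neighbour in
          \<open>far v\<close>. The next line exchanges the roles of \<open>v\<close> and
          \<open>b\<close>.\<close>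
        have "c \<notin> far v" using uniq[OF v a(1) ca(1) a(2)] b ca by blast
        moreover have "c \<notin> far b" using uniq[of b a c v] bV a ca nbrs_sym[of a G b] by blast
        ultimately show ?thesis using ca N_verts by (auto simp: far_def)
      qed
      moreover have "a \<in> N b" using a nbrs_sym by metis
      ultimately show "c \<in> N v \<inter> N b" using a by blast
    qed
    have "card (N a - {v, b}) = card (N a) - 2"
      using bV a v b by (subst card_Diff_subset) (auto simp: far_def)
    moreover have "a \<notin> N a" using N_neq by blast
    ultimately have "card ?C = n - 4" using reg[OF N_verts[OF a(1)]] fin n by simp
    \<comment> \<open>A member of \<open>?C\<close> is adjacent to \<open>b\<close>, hence to no
      other vertex of \<open>far v\<close>.\<close>
    moreover have "a' \<notin> ?C" "a'' \<notin> ?C"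
    proof -
      have "c \<notin> ?C" if "c \<in> N v" "d \<in> N c" "d \<in> far v" "d \<noteq> b" for c d
        using uniq[OF v that(1) that(2), of b] sub that b nbrs_sym[of c G b] by blast
      then show "a' \<notin> ?C" "a'' \<notin> ?C" using a' a'' b' b'' by blast+
    qed
    moreover have "a' \<noteq> a''" using uniq[OF v a'(1) a'(2), of b''] a'' b' b'' by blast
    moreover have "card (insert a' (insert a'' C)) = card C + 2"
      if "a' \<notin> C" "a'' \<notin> C" "a' \<noteq> a''" "finite C" for C
      using that by simp
    moreover have "finite ?C" using fin by simp
    ultimately have "card (insert a' (insert a'' ?C)) = n - 4 + 2" by presburger
    moreover have "insert a' (insert a'' ?C) \<subseteq> N v" using sub a' a'' by blast
    then have "card (insert a' (insert a'' ?C)) \<le> card (N v)" by (rule card_mono[OF fin(2)])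
    ultimately show False using reg[OF v] n by linarith
  qed
  then obtain v a x y where v: "v \<in> verts G" "a \<in> N v" "x \<in> N a" "y \<in> N a" "x \<noteq> y"
    and f: "x \<in> far v" "y \<in> far v" by blast
  then have "N v - {x, y} = N v" "x \<noteq> v" "y \<noteq> v" by (auto simp: far_def)
  then show ?thesis using that[of v a x y] v reg by auto
qed

text \<open>Serves T_n'''. In the regular case, let \<open>x0\<close> in \<open>far v\<close> be
  joined to \<open>a0\<close> in \<open>N v\<close>. If every edge between \<open>N v\<close> and
  \<open>far v\<close> met \<open>a0\<close> or \<open>x0\<close>, then \<open>a0\<close> would be
  adjacent to \<open>v\<close> and to all of \<open>far v\<close>, giving it degree at least
  \<open>n - 2\<close>.\<close>

lemma two_matching:
  obtains v a b x y where "v \<in> verts G" "a \<in> N v" "b \<in> N v" "x \<in> N a" "y \<in> N b"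
    "distinct [v, a, b, x, y]" "card (N v - {x, y}) \<ge> n - 3"
proof (cases "\<exists>v \<in> verts G. card (N v) \<ge> n - 2")
  case True
  then obtain v a x where v: "v \<in> verts G" "a \<in> N v" "x \<in> N a" "x \<noteq> v"
    and c: "card (N v - {x}) \<ge> n - 2" using large_degree_edge by blast
  obtain b where b: "b \<in> N v - {x}" "b \<notin> set [a]"
    by (rule bexE[OF exists_avoiding[of "[a]" "N v - {x}"]]) (use c n in auto)
  obtain y where y: "y \<in> N b" "y \<notin> set [v, a, x]"
    by (rule pick_nbr[of b v "[v, a, x]"]) (use b n in auto)
  have "card (N v - {x} - {y}) \<ge> card (N v - {x}) - 1"
    by (simp add: card_Diff_singleton_if)
  moreover have "N v - {x} - {y} = N v - {x, y}" by blast
  ultimately have "card (N v - {x, y}) \<ge> n - 3" using c by simp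
  then show ?thesis using that[of v a b x y] v b y N_neq by auto
next
  case False
  then have reg: "card (N v) = n - 3" if "v \<in> verts G" for v
    using min_degree that by fastforce
  have "verts G \<noteq> {}" using card_verts n by auto
  then obtain v where v: "v \<in> verts G" by blast
  have cfar: "card (far v) = n - 3" using card_far reg v n by simp
  obtain x0 where x0: "x0 \<in> far v"
    by (rule bexE[OF exists_avoiding[of "[]" "far v"]]) (use cfar n in auto)
  obtain a0 where a0: "a0 \<in> N v" "x0 \<in> N a0" using far_common_nbr v x0 by blast
  have "\<exists>a \<in> N v. \<exists>x \<in> far v. x \<in> N a \<and> a \<noteq> a0 \<and> x \<noteq> x0"
  proof (rule ccontr)
    assume neg: "\<not> ?thesis"
    have "far v \<subseteq> N a0"
    proof
      fix x assume x: "x \<in> far v"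
      then obtain a where "a \<in> N v" "x \<in> N a" using far_common_nbr v by blast
      then show "x \<in> N a0" using neg x a0 by blast
    qed
    moreover have "v \<in> N a0" using a0 nbrs_sym by metis
    ultimately have "insert v (far v) \<subseteq> N a0" by blast
    moreover have "card (insert v (far v)) = n - 2"
      using cfar n fin by (simp add: far_def)
    ultimately show False
      using card_mono[OF fin(2), of "insert v (far v)" a0] reg[OF N_verts[OF a0(1)]] n by simp
  qed
  then obtain a x where ax: "a \<in> N v" "x \<in> far v" "x \<in> N a" "a \<noteq> a0" "x \<noteq> x0" by blast
  then have "N v - {x0, x} = N v" using x0 by (auto simp: far_def)
  then show ?thesis
    using that[of v a0 a x0 x] ax a0 x0 v N_neq reg by (auto simp: far_def)
qed

lemma contains_Tn3: "contains_copy G (Tn3 n)"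
proof -
  obtain v a x y where v: "v \<in> verts G" "a \<in> N v" "x \<in> N a" "y \<in> N a" "distinct [v, x, y]"
    and c: "card (N v - {x, y}) \<ge> n - 3" by (rule fork)
  \<comment> \<open>A third leaf at \<open>a\<close> costs at most one further neighbour of
    \<open>v\<close>, so \<open>n - 4\<close> remain.\<close>
  obtain z where z: "z \<in> N a" "z \<notin> set [v, x, y]"
    by (rule pick_nbr[of a v "[v, x, y]"]) (use v n in auto)
  have "card (N v - {x, y} - {z}) \<ge> n - 4"
    using c by (auto simp: card_Diff_singleton_if)
  then show ?thesis unfolding Tn3_eq
    by (intro contains_branch_tree[OF simple, where h = "\<lambda>_. a" and v = v and x = x and y = y
          and z = z and A = "N v - {x, y} - {z}"])
      (use v z n N_neq[of x a] N_neq[of y a] N_neq[of z a] in auto)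
qed

lemma contains_Tn'': "contains_copy G (Tn'' n)"
proof -
  obtain v a x y where v: "v \<in> verts G" "a \<in> N v" "x \<in> N a" "y \<in> N a" "distinct [v, x, y]"
    and c: "card (N v - {x, y}) \<ge> n - 3" by (rule fork)
  obtain b where b: "b \<in> N v - {x, y}" "b \<notin> set [a]"
    by (rule bexE[OF exists_avoiding[of "[a]" "N v - {x, y}"]]) (use c n in auto)
  \<comment> \<open>\<open>z\<close> must avoid \<open>a\<close> as well, since \<open>a\<close> has
    to stay in the set that hosts the neighbours of the centre.\<close>
  obtain z where z: "z \<in> N b" "z \<notin> set [v, a, x, y]"
    by (rule pick_nbr[of b v "[v, a, x, y]"]) (use b n in auto)
  have "card (N v - {x, y} - {z}) \<ge> n - 4"
    using c by (auto simp: card_Diff_singleton_if)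
  then show ?thesis unfolding Tn''_eq
    by (intro contains_branch_tree[OF simple, where h = "\<lambda>i. if i = 1 then a else b" and v = v
          and x = x and y = y and z = z and A = "N v - {x, y} - {z}"])
      (use v b z n N_neq[of x a] N_neq[of y a] N_neq[of z b] in auto)
qed

lemma contains_Tn''': "contains_copy G (Tn''' n)"
proof -
  obtain v a b x y where v: "v \<in> verts G" "a \<in> N v" "b \<in> N v" "x \<in> N a" "y \<in> N b"
    "distinct [v, a, b, x, y]" and c: "card (N v - {x, y}) \<ge> n - 3" by (rule two_matching)
  obtain d where d: "d \<in> N v - {x, y}" "d \<notin> set [a, b]"
    by (rule bexE[OF exists_avoiding[of "[a, b]" "N v - {x, y}"]]) (use c n in auto)
  \<comment> \<open>Five vertices can be avoided because \<open>n \<ge> 9\<close> gives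
    \<open>5 < n - 3\<close>.\<close>
  obtain z where z: "z \<in> N d" "z \<notin> set [v, a, b, x, y]"
    by (rule pick_nbr[of d v "[v, a, b, x, y]"]) (use d n in auto)
  have "card (N v - {x, y} - {z}) \<ge> n - 4"
    using c by (auto simp: card_Diff_singleton_if)
  then show ?thesis unfolding Tn'''_eq
    by (intro contains_branch_tree[OF simple, where v = v and x = x and y = y and z = z
          and h = "\<lambda>i. if i = 1 then a else if i = 2 then b else d" and A = "N v - {x, y} - {z}"])
      (use v d z n N_neq[of z d] in \<open>auto simp: inj_on_def\<close>)
qed

end

text \<open>Of the \<open>2n - 6\<close> other vertices at most \<open>n - 3\<close> are
  non-neighbours, so at least \<open>n - 3\<close> are neighbours.\<close>

lemma dense_graph_of_small_codegree:
  assumes G: "simple_graph G" and V: "card (verts G) = 2 * n - 5" and n: "n \<ge> 9"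
    and small: "\<And>u. u \<in> verts G \<Longrightarrow> card (nbrs (complement G) u) < n - 2"
  shows "dense_graph G n"
proof
  fix v assume v: "v \<in> verts G"
  have "card (nbrs (complement G) v) = 2 * n - 6 - card (nbrs G v)"
    using nbrs_subset[OF G, of v] finite_nbrs[OF G, of v] v V G
    by (simp add: nbrs_complement card_Diff_subset simple_graph_def)
  then show "card (nbrs G v) \<ge> n - 3" using small[OF v] n by linarith
qed (use assms in auto)

section \<open>The lower bound\<close>

text \<open>The order \<open>N\<close> is a parameter because minimality in
  \<open>ramsey_number\<close> requires a counterexample for every positive order below
  \<open>2n - 5\<close>.\<close>

definition two_cliques :: "nat \<Rightarrow> nat \<Rightarrow> nat sgraph" where
  "two_cliques k N = \<lparr>verts = {0..<N},
     edges = {{a, b} | a b. a < N \<and> b < N \<and> a \<noteq> b \<and> (a < k \<longleftrightarrow> b < k)}\<rparr>"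

lemma verts_two_cliques: "verts (two_cliques k N) = {0..<N}"
  by (simp add: two_cliques_def)

lemma simple_two_cliques: "simple_graph (two_cliques k N)"
  by (auto simp: simple_graph_def two_cliques_def nsets_def card_insert_if)

lemma two_cliques_edge:
  "{a, b} \<in> edges (two_cliques k N) \<longleftrightarrow> a < N \<and> b < N \<and> a \<noteq> b \<and> (a < k \<longleftrightarrow> b < k)"
  by (auto simp: two_cliques_def doubleton_eq_iff)

text \<open>Starting from the image of the centre, every tree vertex stays in the same clique
  \<open>S\<close>, which has at most \<open>n - 3\<close> vertices.\<close>

lemma two_cliques_no_branch_tree:
  assumes n: "n \<ge> 5" and N: "N \<le> 2 * n - 6" and pqr: "{p, q, r} \<subseteq> {1..n - 4}"
  shows "\<not> contains_copy (two_cliques (n - 3) N) (branch_tree n p q r)"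
proof
  assume "contains_copy (two_cliques (n - 3) N) (branch_tree n p q r)"
  then obtain f where inj: "inj_on f {0..n - 1}" and im: "f ` {0..n - 1} \<subseteq> {0..<N}"
    and ed: "\<And>e. e \<in> edges (branch_tree n p q r) \<Longrightarrow> f ` e \<in> edges (two_cliques (n - 3) N)"
    unfolding contains_copy_def verts_two_cliques verts_branch_tree by blast
  define S where "S = {a. a < N \<and> (a < n - 3 \<longleftrightarrow> f 0 < n - 3)}"
  have S: "a \<in> S \<Longrightarrow> {a, b} \<in> edges (two_cliques (n - 3) N) \<Longrightarrow> b \<in> S" for a b
    by (auto simp: S_def two_cliques_edge)
  have "f 0 \<in> S" using im by (force simp: S_def)
  have near: "f i \<in> S" if "i \<in> {1..n - 4}" for i
    using S[OF \<open>f 0 \<in> S\<close>, of "f i"] ed[OF branch_tree_edges(1)[OF that]] by simp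
  then have pqrS: "f p \<in> S" "f q \<in> S" "f r \<in> S" using pqr by auto
  have "f (n - 3) \<in> S" "f (n - 2) \<in> S" "f (n - 1) \<in> S"
    using S[OF pqrS(1), of "f (n - 3)"] S[OF pqrS(2), of "f (n - 2)"] S[OF pqrS(3), of "f (n - 1)"]
      ed[OF branch_tree_edges(2)] ed[OF branch_tree_edges(3)] ed[OF branch_tree_edges(4)]
    by simp_all
  moreover have "{0..n - 1} = {1..n - 4} \<union> {0, n - 3, n - 2, n - 1}" using n by auto
  ultimately have "f ` {0..n - 1} \<subseteq> S" using near \<open>f 0 \<in> S\<close> by auto
  moreover have "S \<subseteq> (if f 0 < n - 3 then {0..<n - 3} else {n - 3..<N})"
    by (auto simp: S_def)
  ultimately have sub: "f ` {0..n - 1} \<subseteq> (if f 0 < n - 3 then {0..<n - 3} else {n - 3..<N})"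
    by blast
  have "card (f ` {0..n - 1}) \<le> card (if f 0 < n - 3 then {0..<n - 3} else {n - 3..<N})"
    by (rule card_mono[OF _ sub]) auto
  moreover have "card (f ` {0..n - 1}) = n" using card_image[OF inj] n by simp
  ultimately show False using N n by (auto split: if_splits)
qed

text \<open>In the complement a vertex is adjacent only to the opposite clique, hence to at most
  \<open>n - 3\<close> vertices, while the centre needs \<open>n - 2\<close>.\<close>

lemma two_cliques_no_Tn':
  assumes n: "n \<ge> 4" and N: "N \<le> 2 * n - 6" and T: "is_Tn' n T"
  shows "\<not> contains_copy (complement (two_cliques (n - 3) N)) T"
proof
  let ?H = "complement (two_cliques (n - 3) N)"
  assume "contains_copy ?H T"
  then obtain f where inj: "inj_on f (verts T)" and im: "f ` verts T \<subseteq> {0..<N}"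
    and ed: "\<And>e. e \<in> edges T \<Longrightarrow> f ` e \<in> edges ?H"
    unfolding contains_copy_def verts_complement verts_two_cliques by blast
  obtain c where c: "c \<in> verts T" "card (nbrs T c) = n - 2"
    by (rule is_Tn'_structure[OF T n]) blast
  have G: "simple_graph T" using T by (auto simp: is_Tn'_def is_tree_def)
  have "f ` nbrs T c \<subseteq> nbrs ?H (f c)"
  proof
    fix b assume "b \<in> f ` nbrs T c"
    then obtain a where "b = f a" "{c, a} \<in> edges T" by (auto simp: nbrs_def)
    then show "b \<in> nbrs ?H (f c)" using ed[of "{c, a}"] by (simp add: nbrs_def)
  qed
  also have "nbrs ?H (f c) \<subseteq> (if f c < n - 3 then {n - 3..<N} else {0..<n - 3})"
  proof -
    have "f c \<in> verts (two_cliques (n - 3) N)" "f c < N"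
      using im c by (auto simp: two_cliques_def)
    then show ?thesis
      by (subst nbrs_complement) (auto simp: nbrs_def two_cliques_edge, auto simp: two_cliques_def)
  qed
  finally have sub: "f ` nbrs T c \<subseteq> (if f c < n - 3 then {n - 3..<N} else {0..<n - 3})" .
  have "card (f ` nbrs T c) \<le> card (if f c < n - 3 then {n - 3..<N} else {0..<n - 3})"
    by (rule card_mono[OF _ sub]) auto
  moreover have "card (f ` nbrs T c) = n - 2"
    using c nbrs_subset[OF G, of c] inj_on_subset[OF inj] by (subst card_image) auto
  ultimately show False using N n by (auto split: if_splits)
qed

section \<open>Assembling both bounds\<close>

text \<open>The assumption \<open>dense\<close> isolates the only part of the argument that depends
  on which of the three trees is meant.\<close>

lemma ramsey_branch_tree_eq:
  assumes n: "n \<ge> 9" and T: "is_Tn' n T" and pqr: "{p, q, r} \<subseteq> {1..n - 4}"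
    and dense: "\<And>G :: nat sgraph. dense_graph G n \<Longrightarrow> contains_copy G (branch_tree n p q r)"
  shows "ramsey_number (branch_tree n p q r) T = 2 * n - 5"
  unfolding ramsey_number_def
proof (rule Least_equality, intro conjI allI impI)
  show "2 * n - 5 > 0" using n by simp
next
  fix G :: "nat sgraph"
  assume G: "simple_graph G \<and> card (verts G) = 2 * n - 5"
  show "contains_copy G (branch_tree n p q r) \<or> contains_copy (complement G) T"
  proof (cases "\<exists>u \<in> verts G. card (nbrs (complement G) u) \<ge> n - 2")
    case True
    then show ?thesis
      using large_codegree_contains_branch_tree[of G n p q r T] G T n pqr by auto
  next
    case False
    then show ?thesis using dense dense_graph_of_small_codegree[of G n] G n by (simp add: not_le)
  qed
next
  fix N assume N: "0 < N \<and> (\<forall>G :: nat sgraph. simple_graph G \<and> card (verts G) = N \<longrightarrow>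
        contains_copy G (branch_tree n p q r) \<or> contains_copy (complement G) T)"
  show "2 * n - 5 \<le> N"
  proof (rule ccontr)
    assume "\<not> 2 * n - 5 \<le> N"
    then have "N \<le> 2 * n - 6" by simp
    moreover have "card (verts (two_cliques (n - 3) N)) = N" by (simp add: two_cliques_def)
    ultimately show False
      using N simple_two_cliques two_cliques_no_branch_tree[of n N p q r]
        two_cliques_no_Tn'[of n N T] T pqr n by auto
  qed
qed

theorem theorem3p3:
  fixes n :: nat and T' :: "'a sgraph"
  assumes "n \<ge> 10"
    and "is_Tn' n T'"
  shows "ramsey_number (Tn'' n) T' = 2 * n - 5 \<and>
         ramsey_number (Tn''' n) T' = 2 * n - 5 \<and>
         ramsey_number (Tn3 n) T' = 2 * n - 5"
proof -
  have n: "n \<ge> 9" using assms by simp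
  note R = ramsey_branch_tree_eq[OF n assms(2)]
  have "ramsey_number (Tn'' n) T' = 2 * n - 5"
    unfolding Tn''_eq using n dense_graph.contains_Tn''[of _ n]
    by (intro R) (auto simp: Tn''_eq)
  moreover have "ramsey_number (Tn''' n) T' = 2 * n - 5"
    unfolding Tn'''_eq using n dense_graph.contains_Tn'''[of _ n]
    by (intro R) (auto simp: Tn'''_eq)
  moreover have "ramsey_number (Tn3 n) T' = 2 * n - 5"
    unfolding Tn3_eq using n dense_graph.contains_Tn3[of _ n]
    by (intro R) (auto simp: Tn3_eq)
  ultimately show ?thesis by blast
qed

end
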